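(* Let $\mathbf A$ be a finite hoop and let $\mathbf M$ be a finite MV-chain with at least two elements. Let $P_{\mathbf A}^{\mathbf M}$ be the set of all product morphisms from $\mathbf A$ to $\mathbf M$, $P_{\mathbf M}^{\mathbf A}$ the set of all product morphisms from $\mathbf M$ to $\mathbf A$, and $\mathbf{Id}\,\mathbf A=\{x\in A\mid x\cdot x=x\}$. Then there exist bijections $\nu\colon P_{\mathbf A}^{\mathbf M}\to\mathbf{Id}\,\mathbf A$ and $\mu\colon P_{\mathbf M}^{\mathbf A}\to\mathbf{Id}\,\mathbf A$.
   Context: A hoop is an algebra $\mathbf A=(A;\cdot,\rightarrow,1)$ of type $\langle 2,2,0\rangle$ such that $(A;\cdot,1)$ is a commutative monoid and the identities $x\rightarrow x=1$, $(x\cdot y)\rightarrow z=x\rightarrow(y\rightarrow z)$ and $x\cdot(x\rightarrow y)=y\cdot(y\rightarrow x)$ hold. The order is $x\leq y$ iff $x\rightarrow y=1$; infima exist and $x\wedge y=x\cdot(x\rightarrow y)$. A finite MV-chain is regarded as a hoop via its reduct $(M;\cdot,\rightarrow,1)$. A map $f\colon B\to C$ between hoops is a product morphism if $f(1)=1$ and $f(x)\cdot f(y)=f(x\cdot y)=f(x)\wedge f(y)=f(x\wedge y)$ for all $x,y\in B$. *)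

theory Defs
  imports "HOL-Algebra.Group"
begin

record 'a hoop = "'a monoid" +
  imp :: "'a \<Rightarrow> 'a \<Rightarrow> 'a" (infixr "\<leadsto>\<index>" 65)

locale hoop = comm_monoid A for A :: "('a, 'm) hoop_scheme" (structure) +
  assumes imp_closed: "\<lbrakk>x \<in> carrier A; y \<in> carrier A\<rbrakk> \<Longrightarrow> x \<leadsto> y \<in> carrier A"
    and imp_self: "x \<in> carrier A \<Longrightarrow> x \<leadsto> x = \<one>"
    and imp_curry: "\<lbrakk>x \<in> carrier A; y \<in> carrier A; z \<in> carrier A\<rbrakk>
      \<Longrightarrow> (x \<otimes> y) \<leadsto> z = x \<leadsto> (y \<leadsto> z)"
    and divisibility: "\<lbrakk>x \<in> carrier A; y \<in> carrier A\<rbrakk>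
      \<Longrightarrow> x \<otimes> (x \<leadsto> y) = y \<otimes> (y \<leadsto> x)"

definition hoop_le :: "('a, 'm) hoop_scheme \<Rightarrow> 'a \<Rightarrow> 'a \<Rightarrow> bool" where
  "hoop_le A x y \<longleftrightarrow> x \<leadsto>\<^bsub>A\<^esub> y = \<one>\<^bsub>A\<^esub>"

definition hoop_inf :: "('a, 'm) hoop_scheme \<Rightarrow> 'a \<Rightarrow> 'a \<Rightarrow> 'a" where
  "hoop_inf A x y = x \<otimes>\<^bsub>A\<^esub> (x \<leadsto>\<^bsub>A\<^esub> y)"

definition idempotents :: "('a, 'm) hoop_scheme \<Rightarrow> 'a set" where
  "idempotents A = {x \<in> carrier A. x \<otimes>\<^bsub>A\<^esub> x = x}"

text \<open>Maps are taken extensional on the carrier, so that two product morphisms are equal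
  as soon as they agree on \<^term>\<open>carrier B\<close>.\<close>

definition product_morphisms ::
  "('a, 'm) hoop_scheme \<Rightarrow> ('b, 'n) hoop_scheme \<Rightarrow> ('a \<Rightarrow> 'b) set" where
  "product_morphisms B C = {f \<in> carrier B \<rightarrow>\<^sub>E carrier C.
     f \<one>\<^bsub>B\<^esub> = \<one>\<^bsub>C\<^esub> \<and>
     (\<forall>x \<in> carrier B. \<forall>y \<in> carrier B.
        f x \<otimes>\<^bsub>C\<^esub> f y = f (x \<otimes>\<^bsub>B\<^esub> y) \<and>
        f (x \<otimes>\<^bsub>B\<^esub> y) = hoop_inf C (f x) (f y) \<and>
        hoop_inf C (f x) (f y) = f (hoop_inf B x y))}"

text \<open>MV-algebras in Chang's signature, with truncated sum, negation and zero.\<close>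

record 'a mv_algebra = "'a partial_object" +
  mv_plus :: "'a \<Rightarrow> 'a \<Rightarrow> 'a" (infixl "\<oplus>\<index>" 65)
  mv_neg :: "'a \<Rightarrow> 'a" ("\<sim>\<index> _" [81] 80)
  mv_zero :: 'a ("\<zero>\<index>")

locale mv_algebra =
  fixes M :: "('a, 'm) mv_algebra_scheme" (structure)
  assumes plus_comm_monoid:
      "comm_monoid \<lparr>carrier = carrier M, mult = mv_plus M, one = mv_zero M\<rparr>"
    and neg_closed: "x \<in> carrier M \<Longrightarrow> \<sim> x \<in> carrier M"
    and neg_neg: "x \<in> carrier M \<Longrightarrow> \<sim> (\<sim> x) = x"
    and plus_neg_zero: "x \<in> carrier M \<Longrightarrow> x \<oplus> \<sim> \<zero> = \<sim> \<zero>"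
    and lukasiewicz: "\<lbrakk>x \<in> carrier M; y \<in> carrier M\<rbrakk>
      \<Longrightarrow> \<sim> (\<sim> x \<oplus> y) \<oplus> y = \<sim> (\<sim> y \<oplus> x) \<oplus> x"

definition mv_hoop :: "('a, 'm) mv_algebra_scheme \<Rightarrow> 'a hoop" where
  "mv_hoop M = \<lparr>carrier = carrier M,
     mult = (\<lambda>x y. \<sim>\<^bsub>M\<^esub> (\<sim>\<^bsub>M\<^esub> x \<oplus>\<^bsub>M\<^esub> \<sim>\<^bsub>M\<^esub> y)),
     one = \<sim>\<^bsub>M\<^esub> \<zero>\<^bsub>M\<^esub>,
     imp = (\<lambda>x y. \<sim>\<^bsub>M\<^esub> x \<oplus>\<^bsub>M\<^esub> y)\<rparr>"

locale mv_chain = mv_algebra +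
  assumes le_total: "\<lbrakk>x \<in> carrier M; y \<in> carrier M\<rbrakk>
    \<Longrightarrow> hoop_le (mv_hoop M) x y \<or> hoop_le (mv_hoop M) y x"

lemma (in mv_algebra) hoop_mv_hoop: "hoop (mv_hoop M)"
proof -
  interpret P: comm_monoid "\<lparr>carrier = carrier M, mult = mv_plus M, one = mv_zero M\<rparr>"
    by (rule plus_comm_monoid)
  have z: "\<zero> \<in> carrier M" using P.one_closed by simp
  have c: "x \<oplus> y \<in> carrier M" if "x \<in> carrier M" "y \<in> carrier M" for x y
    using P.m_closed that by simp
  have a: "x \<oplus> y \<oplus> w = x \<oplus> (y \<oplus> w)"
    if "x \<in> carrier M" "y \<in> carrier M" "w \<in> carrier M" for x y w
    using P.m_assoc that by simp
  have k: "x \<oplus> y = y \<oplus> x" if "x \<in> carrier M" "y \<in> carrier M" for x y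
    using P.m_comm that by simp
  have u: "\<zero> \<oplus> x = x" if "x \<in> carrier M" for x
    using P.l_one that by simp
  have s: "\<sim> x \<oplus> x = \<sim> \<zero>" if x: "x \<in> carrier M" for x
  proof -
    have "\<sim> (\<sim> (\<sim> \<zero>) \<oplus> x) \<oplus> x = \<sim> (\<sim> x \<oplus> \<sim> \<zero>) \<oplus> \<sim> \<zero>"
      using lukasiewicz x z neg_closed by blast
    then show ?thesis
      using x z by (simp add: neg_neg neg_closed u plus_neg_zero)
  qed
  have d: "\<sim> (\<sim> x \<oplus> \<sim> (\<sim> x \<oplus> y)) = \<sim> (\<sim> y \<oplus> \<sim> (\<sim> y \<oplus> x))"
    if "x \<in> carrier M" "y \<in> carrier M" for x y
    using lukasiewicz[of "\<sim> x" "\<sim> y"] lukasiewicz[of "\<sim> y" "\<sim> x"] that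
    by (simp add: neg_neg neg_closed c k)
  show ?thesis
    unfolding mv_hoop_def
    by unfold_locales
      (simp_all add: z c neg_closed neg_neg a u s d, simp_all add: k a c u neg_closed neg_neg z)
qed

end

theory Submission
  imports Defs
begin

text \<open>Every value of a product morphism is idempotent, and a finite MV-chain with at least two
  elements has exactly two idempotents, \<open>0\<close> and \<open>1\<close>. Hence a product morphism \<open>A \<rightarrow> M\<close> is the
  indicator of the filter of elements sent to \<open>1\<close>; by finiteness this filter is the up-set of its
  least element, which is idempotent. In the other direction, the elements \<open>\<noteq> 1\<close> of \<open>M\<close> with a
  given value form a finite multiplicatively closed set, which contains an idempotent, necessarily
  \<open>0\<close>; so a product morphism \<open>M \<rightarrow> A\<close> is constant off \<open>1\<close>, with an
  arbitrary idempotent of \<open>A\<close> as value.\<close>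

section \<open>Order, meets and idempotents in a hoop\<close>

context hoop
begin

text \<open>With \<open>u = x \<leadsto> \<one>\<close>, divisibility of \<open>x\<close> and
  \<open>\<one>\<close> reads \<open>x \<otimes> u = \<one> \<leadsto> x\<close>, so the goal is
  that \<open>u\<close> is absorbed by \<open>x\<close>. Since \<open>x\<close> lies below
  \<open>\<one> \<leadsto> x\<close>, divisibility writes \<open>x\<close> as
  \<open>x \<otimes> u \<otimes> (u \<leadsto> \<one>)\<close>, and
  \<open>u \<otimes> (u \<leadsto> \<one>) = u\<close>.\<close>

lemma one_imp:
  assumes x: "x \<in> carrier A"
  shows "\<one> \<leadsto> x = x"
proof -
  define u where "u = x \<leadsto> \<one>"
  have u: "u \<in> carrier A" using x by (simp add: u_def imp_closed)
  have one_u: "\<one> \<leadsto> u = u" using x imp_curry[of \<one> x \<one>] by (simp add: u_def)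
  have xu: "x \<otimes> u = \<one> \<leadsto> x" using x divisibility[of x \<one>] by (simp add: u_def imp_closed)
  have uu: "u \<otimes> (u \<leadsto> \<one>) = u" using u one_u divisibility[of u \<one>] by simp
  have "x \<leadsto> (\<one> \<leadsto> x) = \<one>" using x imp_curry[of x \<one> x] by (simp add: imp_self)
  then have "x = (\<one> \<leadsto> x) \<otimes> ((\<one> \<leadsto> x) \<leadsto> x)"
    using x divisibility[of x "\<one> \<leadsto> x"] by (simp add: imp_closed)
  \<comment> \<open>Currying turns \<open>(u \<otimes> x) \<leadsto> x\<close> into
    \<open>u \<leadsto> (x \<leadsto> x)\<close>.\<close>
  also have "(\<one> \<leadsto> x) \<leadsto> x = u \<leadsto> \<one>"
    using x u imp_curry[of u x x] by (simp add: xu[symmetric] m_comm imp_self)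
  also have "(\<one> \<leadsto> x) \<otimes> (u \<leadsto> \<one>) = x \<otimes> u"
    using x u uu by (simp add: xu[symmetric] m_assoc imp_closed)
  finally show ?thesis using xu by simp
qed

text \<open>By \<open>one_imp\<close>, divisibility of \<open>x\<close> and \<open>\<one>\<close>
  gives \<open>u \<otimes> x = x\<close>; currying \<open>(u \<otimes> x) \<leadsto> \<one>\<close>
  then yields \<open>u = u \<leadsto> u = \<one>\<close>.\<close>

lemma imp_one:
  assumes x: "x \<in> carrier A"
  shows "x \<leadsto> \<one> = \<one>"
proof -
  define u where "u = x \<leadsto> \<one>"
  have u: "u \<in> carrier A" using x by (simp add: u_def imp_closed)
  have "u \<otimes> x = x"
    using x u divisibility[of x \<one>] one_imp[OF x] by (simp add: u_def m_comm)
  then show ?thesis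
    using imp_curry[of u x \<one>] x u by (simp add: u_def[symmetric] imp_self)
qed

text \<open>The hoop order is reverse divisibility in the monoid; later order arguments become
  computations with factors.\<close>

lemma le_iff_factor:
  assumes "x \<in> carrier A" "y \<in> carrier A"
  shows "hoop_le A x y \<longleftrightarrow> (\<exists>z\<in>carrier A. x = y \<otimes> z)"
proof
  assume "hoop_le A x y"
  then have "x = y \<otimes> (y \<leadsto> x)"
    using assms divisibility[of x y] by (simp add: hoop_le_def)
  then show "\<exists>z\<in>carrier A. x = y \<otimes> z" using assms imp_closed by blast
next
  assume "\<exists>z\<in>carrier A. x = y \<otimes> z"
  then obtain z where z: "z \<in> carrier A" "x = z \<otimes> y" using assms m_comm by auto
  then show "hoop_le A x y"
    using assms by (simp add: hoop_le_def imp_curry imp_self imp_one)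
qed

lemma le_refl: "x \<in> carrier A \<Longrightarrow> hoop_le A x x"
  by (simp add: hoop_le_def imp_self)

lemma le_antisym:
  "\<lbrakk>x \<in> carrier A; y \<in> carrier A; hoop_le A x y; hoop_le A y x\<rbrakk> \<Longrightarrow> x = y"
  using divisibility[of x y] by (simp add: hoop_le_def)

lemma le_trans:
  assumes "x \<in> carrier A" "y \<in> carrier A" "z \<in> carrier A" "hoop_le A x y" "hoop_le A y z"
  shows "hoop_le A x z"
proof -
  obtain a b where "a \<in> carrier A" "x = y \<otimes> a" "b \<in> carrier A" "y = z \<otimes> b"
    using assms le_iff_factor by metis
  then show ?thesis using assms le_iff_factor[of x z] m_assoc by blast
qed

lemma mult_le_left: "\<lbrakk>x \<in> carrier A; y \<in> carrier A\<rbrakk> \<Longrightarrow> hoop_le A (x \<otimes> y) x"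
  using le_iff_factor by blast

lemma mult_le_right: "\<lbrakk>x \<in> carrier A; y \<in> carrier A\<rbrakk> \<Longrightarrow> hoop_le A (x \<otimes> y) y"
  using mult_le_left[of y x] by (simp add: m_comm)

lemma one_le_iff: "x \<in> carrier A \<Longrightarrow> hoop_le A \<one> x \<longleftrightarrow> x = \<one>"
  by (simp add: hoop_le_def one_imp)

lemma mult_eq_one_iff:
  assumes "x \<in> carrier A" "y \<in> carrier A"
  shows "x \<otimes> y = \<one> \<longleftrightarrow> x = \<one> \<and> y = \<one>"
  using assms mult_le_left[OF assms] mult_le_right[OF assms] one_le_iff by auto

lemma inf_closed: "\<lbrakk>x \<in> carrier A; y \<in> carrier A\<rbrakk> \<Longrightarrow> hoop_inf A x y \<in> carrier A"
  by (simp add: hoop_inf_def imp_closed)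

lemma inf_le_left: "\<lbrakk>x \<in> carrier A; y \<in> carrier A\<rbrakk> \<Longrightarrow> hoop_le A (hoop_inf A x y) x"
  by (simp add: hoop_inf_def imp_closed mult_le_left)

lemma inf_le_right: "\<lbrakk>x \<in> carrier A; y \<in> carrier A\<rbrakk> \<Longrightarrow> hoop_le A (hoop_inf A x y) y"
  by (simp add: hoop_inf_def divisibility[of x y] imp_closed mult_le_left)

lemma inf_idem: "x \<in> carrier A \<Longrightarrow> hoop_inf A x x = x"
  by (simp add: hoop_inf_def imp_self)

lemma inf_one_left: "x \<in> carrier A \<Longrightarrow> hoop_inf A \<one> x = x"
  by (simp add: hoop_inf_def one_imp)

lemma inf_one_right: "x \<in> carrier A \<Longrightarrow> hoop_inf A x \<one> = x"
  by (simp add: hoop_inf_def imp_one)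

lemma inf_eq_one_iff:
  assumes "x \<in> carrier A" "y \<in> carrier A"
  shows "hoop_inf A x y = \<one> \<longleftrightarrow> x = \<one> \<and> y = \<one>"
  using assms inf_le_left[OF assms] inf_le_right[OF assms] one_le_iff inf_idem[of \<one>] by auto

text \<open>Because \<open>y\<close> lies below \<open>x \<leadsto> y\<close>, it factors as
  \<open>(x \<leadsto> y) \<otimes> c\<close>, and multiplying by \<open>x\<close> exhibits
  \<open>x \<otimes> y\<close> as a multiple of the meet.\<close>

lemma mult_le_inf:
  assumes x: "x \<in> carrier A" and y: "y \<in> carrier A"
  shows "hoop_le A (x \<otimes> y) (hoop_inf A x y)"
proof -
  have "hoop_le A y (x \<leadsto> y)"
    using x y imp_curry[of y x y] mult_le_left[OF y x] by (simp add: hoop_le_def)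
  then obtain c where c: "c \<in> carrier A" "y = (x \<leadsto> y) \<otimes> c"
    using x y le_iff_factor imp_closed by metis
  have "x \<otimes> y = hoop_inf A x y \<otimes> c"
    using x y c(1) by (subst c(2)) (simp add: hoop_inf_def m_assoc imp_closed)
  then show ?thesis using x y c(1) inf_closed mult_le_left by metis
qed

text \<open>For the converse, a common lower bound \<open>e = x \<otimes> a = y \<otimes> b\<close>
  satisfies \<open>e = e \<otimes> e = (x \<otimes> y) \<otimes> (a \<otimes> b)\<close>. With the
  analogue for meets below, this makes the indicator of the up-set of \<open>e\<close> respect both
  operations.\<close>

lemma idempotent_le_mult_iff:
  assumes e: "e \<in> idempotents A" and x: "x \<in> carrier A" and y: "y \<in> carrier A"
  shows "hoop_le A e (x \<otimes> y) \<longleftrightarrow> hoop_le A e x \<and> hoop_le A e y"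
proof
  have e': "e \<in> carrier A" using e by (simp add: idempotents_def)
  show "hoop_le A e x \<and> hoop_le A e y" if "hoop_le A e (x \<otimes> y)"
    using that e' x y le_trans mult_le_left mult_le_right m_closed by meson
  assume "hoop_le A e x \<and> hoop_le A e y"
  then obtain a b where ab: "a \<in> carrier A" "e = x \<otimes> a" "b \<in> carrier A" "e = y \<otimes> b"
    using e' x y le_iff_factor by metis
  have "e = e \<otimes> e" using e by (simp add: idempotents_def)
  also have "\<dots> = (x \<otimes> a) \<otimes> (y \<otimes> b)" using ab by simp
  also have "\<dots> = (x \<otimes> y) \<otimes> (a \<otimes> b)" using ab x y by (simp add: m_ac)
  finally show "hoop_le A e (x \<otimes> y)" using e' ab x y le_iff_factor by blast
qed

lemma idempotent_le_inf_iff: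
  assumes e: "e \<in> idempotents A" and x: "x \<in> carrier A" and y: "y \<in> carrier A"
  shows "hoop_le A e (hoop_inf A x y) \<longleftrightarrow> hoop_le A e x \<and> hoop_le A e y"
proof
  have e': "e \<in> carrier A" using e by (simp add: idempotents_def)
  show "hoop_le A e x \<and> hoop_le A e y" if "hoop_le A e (hoop_inf A x y)"
    using that e' x y le_trans inf_le_left inf_le_right inf_closed by meson
  show "hoop_le A e (hoop_inf A x y)" if "hoop_le A e x \<and> hoop_le A e y"
    using that e' x y idempotent_le_mult_iff[OF e x y] mult_le_inf[OF x y] le_trans
      inf_closed m_closed by meson
qed

text \<open>Multiplying elements of \<open>S\<close> together gives, inside \<open>S\<close>, a
  lower bound of any finite subset, hence of \<open>S\<close> itself. This least element
  \<open>e\<close> lies below \<open>e \<otimes> e\<close>, which always lies below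
  \<open>e\<close>, so it is idempotent.\<close>

lemma finite_mult_closed_least_idempotent:
  assumes S: "S \<subseteq> carrier A" "finite S" "S \<noteq> {}"
    and mult: "\<And>x y. \<lbrakk>x \<in> S; y \<in> S\<rbrakk> \<Longrightarrow> x \<otimes> y \<in> S"
  obtains e where "e \<in> S" "e \<in> idempotents A" "\<And>x. x \<in> S \<Longrightarrow> hoop_le A e x"
proof -
  have "\<exists>e\<in>S. \<forall>x\<in>F. hoop_le A e x" if "finite F" "F \<subseteq> S" for F
    using that
  proof (induction F rule: finite_induct)
    case empty
    then show ?case using S(3) by blast
  next
    case (insert a F)
    then obtain e where e: "e \<in> S" "\<forall>x\<in>F. hoop_le A e x" by auto
    have a: "a \<in> S" using insert.prems by simp
    have ca: "a \<in> carrier A" "e \<in> carrier A" "a \<otimes> e \<in> carrier A" using a e S(1) by auto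
    have "hoop_le A (a \<otimes> e) x" if x: "x \<in> insert a F" for x
    proof (cases "x = a")
      case True
      then show ?thesis using ca mult_le_left by simp
    next
      case False
      then have "hoop_le A e x" "x \<in> carrier A" using x e(2) insert.prems S(1) by auto
      then show ?thesis using ca mult_le_right le_trans by blast
    qed
    then show ?case using mult[OF a e(1)] by blast
  qed
  then obtain e where e: "e \<in> S" "\<forall>x\<in>S. hoop_le A e x" using S(2) by blast
  have "e \<otimes> e \<in> S" using mult e(1) by blast
  then have "e \<otimes> e = e" using e S(1) le_antisym mult_le_left by blast
  then show thesis using that e S(1) by (auto simp: idempotents_def)
qed

end

section \<open>Product morphisms into and out of a hoop with exactly two idempotents\<close>

lemma product_morphismD:
  assumes "f \<in> product_morphisms B C"
  shows product_morphism_extensional: "f \<in> extensional (carrier B)"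
    and product_morphism_closed: "x \<in> carrier B \<Longrightarrow> f x \<in> carrier C"
    and product_morphism_one: "f \<one>\<^bsub>B\<^esub> = \<one>\<^bsub>C\<^esub>"
    and product_morphism_mult: "\<lbrakk>x \<in> carrier B; y \<in> carrier B\<rbrakk>
      \<Longrightarrow> f (x \<otimes>\<^bsub>B\<^esub> y) = f x \<otimes>\<^bsub>C\<^esub> f y"
    and product_morphism_inf: "\<lbrakk>x \<in> carrier B; y \<in> carrier B\<rbrakk>
      \<Longrightarrow> f (hoop_inf B x y) = f x \<otimes>\<^bsub>C\<^esub> f y"
proof -
  have f: "f \<in> carrier B \<rightarrow>\<^sub>E carrier C" "f \<one>\<^bsub>B\<^esub> = \<one>\<^bsub>C\<^esub>"
    "\<forall>x \<in> carrier B. \<forall>y \<in> carrier B. f x \<otimes>\<^bsub>C\<^esub> f y = f (x \<otimes>\<^bsub>B\<^esub> y) \<and>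
        f (x \<otimes>\<^bsub>B\<^esub> y) = hoop_inf C (f x) (f y) \<and> hoop_inf C (f x) (f y) = f (hoop_inf B x y)"
    using assms unfolding product_morphisms_def by blast+
  show "f \<in> extensional (carrier B)" "f \<one>\<^bsub>B\<^esub> = \<one>\<^bsub>C\<^esub>"
    and "x \<in> carrier B \<Longrightarrow> f x \<in> carrier C"
    using f(1,2) by (auto simp: PiE_def)
  show "f (x \<otimes>\<^bsub>B\<^esub> y) = f x \<otimes>\<^bsub>C\<^esub> f y" "f (hoop_inf B x y) = f x \<otimes>\<^bsub>C\<^esub> f y"
    if "x \<in> carrier B" "y \<in> carrier B"
    using f(3) that by metis+
qed

text \<open>The chain of equalities in the definition is split into three equations with the common
  right-hand side \<open>f x \<otimes> f y\<close>.\<close>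

lemma product_morphismI:
  assumes "f \<in> extensional (carrier B)" "\<And>x. x \<in> carrier B \<Longrightarrow> f x \<in> carrier C"
    and "f \<one>\<^bsub>B\<^esub> = \<one>\<^bsub>C\<^esub>"
    and "\<And>x y. \<lbrakk>x \<in> carrier B; y \<in> carrier B\<rbrakk> \<Longrightarrow> f (x \<otimes>\<^bsub>B\<^esub> y) = f x \<otimes>\<^bsub>C\<^esub> f y"
    and "\<And>x y. \<lbrakk>x \<in> carrier B; y \<in> carrier B\<rbrakk> \<Longrightarrow> f (hoop_inf B x y) = f x \<otimes>\<^bsub>C\<^esub> f y"
    and "\<And>x y. \<lbrakk>x \<in> carrier B; y \<in> carrier B\<rbrakk> \<Longrightarrow> hoop_inf C (f x) (f y) = f x \<otimes>\<^bsub>C\<^esub> f y"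
  shows "f \<in> product_morphisms B C"
  using assms by (simp add: product_morphisms_def PiE_def)

text \<open>Products and meets of values agree, and the meet of a value with itself is that
  value.\<close>

lemma product_morphism_value_idempotent:
  assumes "hoop C" "f \<in> product_morphisms B C" "x \<in> carrier B"
  shows "f x \<in> idempotents C"
proof -
  have c: "f x \<in> carrier C" using assms by (simp add: product_morphism_closed)
  have "f x \<otimes>\<^bsub>C\<^esub> f x = hoop_inf C (f x) (f x)"
    using assms by (simp add: product_morphisms_def)
  then show ?thesis using c hoop.inf_idem[OF assms(1) c] by (simp add: idempotents_def)
qed

text \<open>The bijection is given from idempotents to morphisms, where it has an explicit formula:
  the indicator of an up-set.\<close>

lemma product_morphisms_to_two_idempotents:
  assumes "hoop A" and fin: "finite (carrier A)" and "hoop C"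
    and id: "idempotents C = {z, \<one>\<^bsub>C\<^esub>}" and z: "z \<noteq> \<one>\<^bsub>C\<^esub>"
  shows "bij_betw (\<lambda>e. \<lambda>x\<in>carrier A. if hoop_le A e x then \<one>\<^bsub>C\<^esub> else z)
    (idempotents A) (product_morphisms A C)"
proof -
  interpret A: hoop A by fact
  interpret C: hoop C by fact
  have zc: "z \<in> carrier C" "z \<otimes>\<^bsub>C\<^esub> z = z" using id by (auto simp: idempotents_def)
  define h where "h e = (\<lambda>x\<in>carrier A. if hoop_le A e x then \<one>\<^bsub>C\<^esub> else z)" for e
  have Id: "e \<in> carrier A" if "e \<in> idempotents A" for e using that by (simp add: idempotents_def)
  have "inj_on h (idempotents A)"
  proof (rule inj_onI)
    fix d e assume d: "d \<in> idempotents A" and e: "e \<in> idempotents A" and eq: "h d = h e"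
    \<comment> \<open>As \<open>z\<close> differs from \<open>\<one>\<close>, equal indicators have
      equal up-sets; evaluating at \<open>d\<close> and at \<open>e\<close> gives both
      inequalities.\<close>
    have "hoop_le A d x \<longleftrightarrow> hoop_le A e x" if "x \<in> carrier A" for x
      using fun_cong[OF eq, of x] that z by (auto simp: h_def split: if_splits)
    then show "d = e"
      using A.le_refl[OF Id[OF d]] A.le_refl[OF Id[OF e]] Id[OF d] Id[OF e]
      by (intro A.le_antisym) simp_all
  qed
  moreover have "h e \<in> product_morphisms A C" if e: "e \<in> idempotents A" for e
    using Id[OF e] zc
    by (intro product_morphismI)
      (auto simp: h_def A.idempotent_le_mult_iff[OF e] A.idempotent_le_inf_iff[OF e] A.inf_closed
        C.inf_idem C.inf_one_left C.inf_one_right hoop_le_def[of A e "\<one>\<^bsub>A\<^esub>"] A.imp_one)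
  moreover have "f \<in> h ` idempotents A" if f: "f \<in> product_morphisms A C" for f
  proof -
    note fm = product_morphism_mult[OF f] product_morphism_inf[OF f]
    have val: "f x = z \<or> f x = \<one>\<^bsub>C\<^esub>" if "x \<in> carrier A" for x
      using product_morphism_value_idempotent[OF \<open>hoop C\<close> f that] id by auto
    define F where "F = {x \<in> carrier A. f x = \<one>\<^bsub>C\<^esub>}"
    have "F \<subseteq> carrier A" "finite F" "F \<noteq> {}" using fin product_morphism_one[OF f] by (auto simp: F_def)
    moreover have "x \<otimes>\<^bsub>A\<^esub> y \<in> F" if "x \<in> F" "y \<in> F" for x y
      using that by (simp add: F_def fm)
    ultimately obtain e where e: "e \<in> F" "e \<in> idempotents A" "\<And>x. x \<in> F \<Longrightarrow> hoop_le A e x"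
      by (rule A.finite_mult_closed_least_idempotent) blast+
    \<comment> \<open>Upward closure of \<open>F\<close>: the meet of \<open>e\<close> and
      \<open>x\<close> is \<open>e\<close>, so \<open>f e = f e \<otimes> f x\<close> with
      \<open>f e = \<one>\<close>, which rules out \<open>f x = z\<close>.\<close>
    have up: "f x = \<one>\<^bsub>C\<^esub>" if x: "x \<in> carrier A" and le: "hoop_le A e x" for x
    proof -
      have "hoop_inf A e x = e" using le Id[OF e(2)] by (simp add: hoop_inf_def hoop_le_def)
      then have "f e = f e \<otimes>\<^bsub>C\<^esub> f x" using fm(2)[OF Id[OF e(2)] x] by simp
      then show ?thesis using e(1) val[OF x] zc by (auto simp: F_def)
    qed
    have "f = h e"
    proof (rule extensionalityI[OF product_morphism_extensional[OF f]])
      show "h e \<in> extensional (carrier A)" by (simp add: h_def)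
      show "f x = h e x" if "x \<in> carrier A" for x
        using that up[OF that] val[OF that] e(3)[of x] by (auto simp: h_def F_def)
    qed
    then show ?thesis using e(2) by blast
  qed
  ultimately have "bij_betw h (idempotents A) (product_morphisms A C)"
    unfolding bij_betw_def by blast
  then show ?thesis by (simp add: h_def[abs_def])
qed

lemma product_morphisms_from_two_idempotents:
  assumes "hoop A" and "hoop B" and fin: "finite (carrier B)"
    and id: "idempotents B = {z, \<one>\<^bsub>B\<^esub>}" and z: "z \<noteq> \<one>\<^bsub>B\<^esub>"
  shows "bij_betw (\<lambda>f. f z) (product_morphisms B A) (idempotents A)"
proof -
  interpret A: hoop A by fact
  interpret B: hoop B by fact
  have zc: "z \<in> carrier B" using id by (auto simp: idempotents_def)
  have const: "f x = f z" if f: "f \<in> product_morphisms B A" and x: "x \<in> carrier B" "x \<noteq> \<one>\<^bsub>B\<^esub>" for f x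
  proof -
    \<comment> \<open>The fibre of \<open>f\<close> through \<open>x\<close> without
      \<open>\<one>\<close>. Idempotence of \<open>f x\<close> and \<open>mult_eq_one_iff\<close>
      make it closed under products; its idempotent member cannot be \<open>\<one>\<close>, so it is
      \<open>z\<close>.\<close>
    define S where "S = {y \<in> carrier B. y \<noteq> \<one>\<^bsub>B\<^esub> \<and> f y = f x}"
    have "f x \<otimes>\<^bsub>A\<^esub> f x = f x"
      using product_morphism_value_idempotent[OF \<open>hoop A\<close> f x(1)] by (simp add: idempotents_def)
    then have "y \<otimes>\<^bsub>B\<^esub> w \<in> S" if "y \<in> S" "w \<in> S" for y w
      using that by (simp add: S_def B.mult_eq_one_iff product_morphism_mult[OF f])
    moreover have "S \<subseteq> carrier B" "finite S" "S \<noteq> {}" using fin x by (auto simp: S_def)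
    ultimately obtain e where "e \<in> S" "e \<in> idempotents B"
      using B.finite_mult_closed_least_idempotent by metis
    then show ?thesis using id by (auto simp: S_def)
  qed
  have "inj_on (\<lambda>f. f z) (product_morphisms B A)"
  proof (rule inj_onI)
    fix f g assume f: "f \<in> product_morphisms B A" and g: "g \<in> product_morphisms B A"
      and eq: "f z = g z"
    show "f = g"
    proof (rule extensionalityI)
      show "f \<in> extensional (carrier B)" "g \<in> extensional (carrier B)"
        using f g by (simp_all add: product_morphism_extensional)
      show "f x = g x" if "x \<in> carrier B" for x
        using const[OF f that] const[OF g that] eq product_morphism_one[OF f] product_morphism_one[OF g]
        by (cases "x = \<one>\<^bsub>B\<^esub>") simp_all
    qed
  qed
  moreover have "f z \<in> idempotents A" if "f \<in> product_morphisms B A" for f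
    using product_morphism_value_idempotent[OF \<open>hoop A\<close> that zc] .
  moreover have "e \<in> (\<lambda>f. f z) ` product_morphisms B A" if e: "e \<in> idempotents A" for e
  proof -
    \<comment> \<open>A product or a meet equals \<open>\<one>\<close> only if both arguments do, so
      \<open>g\<close> treats the two operations alike; idempotence of \<open>e\<close> settles the
      case of two arguments other than \<open>\<one>\<close>.\<close>
    define g where "g = (\<lambda>x\<in>carrier B. if x = \<one>\<^bsub>B\<^esub> then \<one>\<^bsub>A\<^esub> else e)"
    have "e \<in> carrier A" "e \<otimes>\<^bsub>A\<^esub> e = e" using e by (auto simp: idempotents_def)
    then have "g \<in> product_morphisms B A"
      by (intro product_morphismI)
        (auto simp: g_def B.mult_eq_one_iff B.inf_eq_one_iff B.inf_closed
          A.inf_idem A.inf_one_left A.inf_one_right)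
    moreover have "e = g z" using zc z by (simp add: g_def)
    ultimately show ?thesis by blast
  qed
  ultimately show ?thesis unfolding bij_betw_def by blast
qed

section \<open>Idempotents of an MV-chain\<close>

lemma (in mv_chain) idempotents_mv_hoop: "idempotents (mv_hoop M) = {\<zero>, \<sim> \<zero>}"
proof -
  interpret P: comm_monoid "\<lparr>carrier = carrier M, mult = mv_plus M, one = mv_zero M\<rparr>"
    by (rule plus_comm_monoid)
  interpret H: hoop "mv_hoop M" by (rule hoop_mv_hoop)
  have zc: "\<zero> \<in> carrier M" using P.one_closed by simp
  have l0: "\<zero> \<oplus> x = x" if "x \<in> carrier M" for x using P.l_one that by simp
  have comm: "x \<oplus> y = y \<oplus> x" if "x \<in> carrier M" "y \<in> carrier M" for x y
    using P.m_comm that by simp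
  have "x = \<zero> \<or> x = \<sim> \<zero>" if x: "x \<in> carrier M" and idem: "\<sim> (\<sim> x \<oplus> \<sim> x) = x" for x
  proof -
    have cl: "\<sim> x \<oplus> \<sim> x \<in> carrier M" using P.m_closed x neg_closed by simp
    \<comment> \<open>Totality is applied to \<open>x\<close> and its negation: the cases are
      \<open>x\<close> below \<open>\<sim> x\<close> and \<open>\<sim> x\<close> below
      \<open>x\<close>, written out in the signature of \<open>M\<close>. In the first, idempotence
      gives \<open>x = \<sim> (\<sim> \<zero>)\<close>.\<close>
    consider "\<sim> x \<oplus> \<sim> x = \<sim> \<zero>" | "x \<oplus> x = \<sim> \<zero>"
      using le_total[OF x neg_closed[OF x]] x by (auto simp: hoop_le_def mv_hoop_def neg_neg)
    then show ?thesis
    proof cases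
      case 1
      then show ?thesis using idem zc by (simp add: neg_neg)
    next
      case 2
      \<comment> \<open>Idempotence of \<open>x\<close> for the product is idempotence of
        \<open>\<sim> x\<close> for the sum. The Lukasiewicz axiom at \<open>x\<close> and
        \<open>\<sim> x\<close> then collapses to \<open>x \<oplus> \<sim> x = x\<close>, while the
        left side is also \<open>\<sim> \<zero>\<close>.\<close>
      have "\<sim> x \<oplus> \<sim> x = \<sim> x" using idem cl neg_neg by metis
      then have "x \<oplus> \<sim> x = x"
        using lukasiewicz[OF x neg_closed[OF x]] x zc 2 by (simp add: neg_neg l0)
      moreover have "x \<oplus> \<sim> x = \<sim> \<zero>"
        using H.imp_self[of x] x neg_closed by (simp add: mv_hoop_def comm)
      ultimately show ?thesis by simp
    qed
  qed
  then show ?thesis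
    using zc neg_closed l0 neg_neg plus_neg_zero by (auto simp: idempotents_def mv_hoop_def)
qed

theorem theorem19:
  fixes A :: "('a, 'm) hoop_scheme" and M :: "('b, 'n) mv_algebra_scheme"
  assumes "hoop A" and "finite (carrier A)"
    and "mv_chain M" and "finite (carrier M)" and "card (carrier M) \<ge> 2"
  shows "(\<exists>\<nu>. bij_betw \<nu> (product_morphisms A (mv_hoop M)) (idempotents A)) \<and>
         (\<exists>\<mu>. bij_betw \<mu> (product_morphisms (mv_hoop M) A) (idempotents A))"
proof -
  interpret M: mv_chain M by fact
  interpret P: comm_monoid "\<lparr>carrier = carrier M, mult = mv_plus M, one = mv_zero M\<rparr>"
    by (rule M.plus_comm_monoid)
  have H: "hoop (mv_hoop M)" by (rule M.hoop_mv_hoop)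
  have car: "carrier (mv_hoop M) = carrier M" and one: "\<one>\<^bsub>mv_hoop M\<^esub> = \<sim>\<^bsub>M\<^esub> \<zero>\<^bsub>M\<^esub>"
    by (simp_all add: mv_hoop_def)
  have id: "idempotents (mv_hoop M) = {\<zero>\<^bsub>M\<^esub>, \<one>\<^bsub>mv_hoop M\<^esub>}"
    using M.idempotents_mv_hoop one by simp
  have ne: "\<zero>\<^bsub>M\<^esub> \<noteq> \<one>\<^bsub>mv_hoop M\<^esub>"
  proof
    assume "\<zero>\<^bsub>M\<^esub> = \<one>\<^bsub>mv_hoop M\<^esub>"
    \<comment> \<open>If \<open>\<zero>\<close> and \<open>\<sim> \<zero>\<close> coincide, adding
      this element to \<open>x\<close> gives both \<open>x\<close> and
      \<open>\<sim> \<zero>\<close>, so \<open>M\<close> is trivial.\<close>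
    then have "x = \<zero>\<^bsub>M\<^esub>" if "x \<in> carrier M" for x
      using M.plus_neg_zero[OF that] P.r_one that one by simp
    then have "carrier M \<subseteq> {\<zero>\<^bsub>M\<^esub>}" by blast
    then have "card (carrier M) \<le> 1" using card_mono[of "{\<zero>\<^bsub>M\<^esub>}"] by simp
    then show False using assms(5) by simp
  qed
  \<comment> \<open>The first bijection was built from idempotents to morphisms and has to be
    inverted; the second is evaluation at \<open>\<zero>\<close>.\<close>
  show ?thesis
    using bij_betw_inv_into[OF product_morphisms_to_two_idempotents[OF assms(1,2) H id ne]]
      product_morphisms_from_two_idempotents[OF assms(1) H _ id ne] assms(4) car by auto
qed

end
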